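(* Let $n\ge 4$. For $2\le s\le\lfloor\frac n2\rfloor$ we have $rn(S^1_{n,s})=rn(S_{n,s})$, and for $3\le s\le\lfloor\frac n2\rfloor$ we have $rn(S^2_{n,s})=rn(S_{n,s})$ and $rn(S^{1,2}_{n,s})=rn(S_{n,s})$.
   Context: For a connected graph $G$, $d(u,v)$ is graph distance and $\mathrm{diam}(G)$ the diameter. A radio labeling of $G$ is a function $c:V(G)\to\mathbb{Z}_{+}$ (positive integers) such that for all distinct $u,v$, $d(u,v)+|c(u)-c(v)|\ge\mathrm{diam}(G)+1$; its span is its maximum value, and $rn(G)$ is the minimum span over all radio labelings. All graphs below have vertices $v_1,\dots,v_n$ and contain the path edges $\{v_i,v_{i+1}\}$, $i=1,\dots,n-2$. The spire graph $S_{n,s}$ ($2\le s\le n-2$) additionally has the edge $\{v_s,v_n\}$. The graph $S^1_{n,s}$ ($2\le s\le n$) additionally has edges $\{v_s,v_n\}$ and $\{v_{s-1},v_n\}$. The graph $S^2_{n,s}$ ($3\le s\le n$) additionally has edges $\{v_s,v_n\}$ and $\{v_{s-2},v_n\}$. The graph $S^{1,2}_{n,s}$ ($3\le s\le n$) additionally has edges $\{v_s,v_n\}$, $\{v_{s-1},v_n\}$ and $\{v_{s-2},v_n\}$. *)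

theory Defs
  imports Complex_Main
begin

text \<open>Finite simple graphs are pairs of a vertex set and a set of edges,
  an edge being the two-element set of its endpoints.\<close>

type_synonym 'a graph = "'a set \<times> 'a set set"

definition verts :: "'a graph \<Rightarrow> 'a set" where
  "verts G = fst G"

definition edges :: "'a graph \<Rightarrow> 'a set set" where
  "edges G = snd G"

text \<open>A walk is its nonempty list of vertices; its number of edges is one less than the
  length of the list.\<close>

definition walk :: "'a graph \<Rightarrow> 'a list \<Rightarrow> bool" where
  "walk G p \<longleftrightarrow> p \<noteq> [] \<and> set p \<subseteq> verts G \<and>
     (\<forall>i. Suc i < length p \<longrightarrow> {p ! i, p ! Suc i} \<in> edges G)"

text \<open>The distance and the diameter are meaningful only for connected (nonempty, finite) graphs,
  the only ones considered here.\<close>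

definition gdist :: "'a graph \<Rightarrow> 'a \<Rightarrow> 'a \<Rightarrow> nat" where
  "gdist G u v = (LEAST k. \<exists>p. walk G p \<and> hd p = u \<and> last p = v \<and> length p = Suc k)"

definition diam :: "'a graph \<Rightarrow> nat" where
  "diam G = Max {gdist G u v | u v. u \<in> verts G \<and> v \<in> verts G}"

definition radio_labeling :: "'a graph \<Rightarrow> ('a \<Rightarrow> int) \<Rightarrow> bool" where
  "radio_labeling G c \<longleftrightarrow>
     (\<forall>v \<in> verts G. c v > 0) \<and>
     (\<forall>u \<in> verts G. \<forall>v \<in> verts G. u \<noteq> v \<longrightarrow>
        int (gdist G u v) + \<bar>c u - c v\<bar> \<ge> int (diam G) + 1)"

definition label_span :: "'a graph \<Rightarrow> ('a \<Rightarrow> int) \<Rightarrow> int" where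
  "label_span G c = Max (c ` verts G)"

text \<open>Spans are positive, so the minimum is taken over natural numbers.\<close>

definition rn :: "'a graph \<Rightarrow> nat" where
  "rn G = (LEAST k. \<exists>c. radio_labeling G c \<and> label_span G c = int k)"

text \<open>The vertex \<open>v\<^sub>i\<close> is the number \<open>i\<close>.\<close>

definition path_edges :: "nat \<Rightarrow> nat set set" where
  "path_edges n = {{i, i + 1} | i. 1 \<le> i \<and> i \<le> n - 2}"

definition spire :: "nat \<Rightarrow> nat \<Rightarrow> nat graph" where
  "spire n s = ({1..n}, path_edges n \<union> {{s, n}})"

definition spire1 :: "nat \<Rightarrow> nat \<Rightarrow> nat graph" where
  "spire1 n s = ({1..n}, path_edges n \<union> {{s, n}, {s - 1, n}})"

definition spire2 :: "nat \<Rightarrow> nat \<Rightarrow> nat graph" where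
  "spire2 n s = ({1..n}, path_edges n \<union> {{s, n}, {s - 2, n}})"

definition spire12 :: "nat \<Rightarrow> nat \<Rightarrow> nat graph" where
  "spire12 n s = ({1..n}, path_edges n \<union> {{s, n}, {s - 1, n}, {s - 2, n}})"

end

theory Submission
  imports Defs
begin

text \<open>All the graphs have diameter \<open>n - 2\<close> and the same radio number, given by an explicit formula.
  For the lower bound only the distances of the spire graph matter, as those of the others are not
  larger. Order the vertices by label and weight each by (twice) its distance to the centre of the
  path: every gap between consecutive labels is at least \<open>n - 1\<close> minus half the sum of two weights,
  so the span is determined by the total weight, the weights of the two ends, and the excess of the
  gaps. For even \<open>n > 2s\<close>, the condition on labels two steps apart forces some excess near the right
  end of the path. For the upper bound, as \<open>s \<le> n div 2\<close>, the vertex \<open>v\<^sub>n\<close> can be placed between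
  vertices of the right half, whose distances to \<open>v\<^sub>n\<close> do not depend on the additional edges; a
  zigzag order with \<open>v\<^sub>n\<close> inserted attains the bound in all the graphs at once.\<close>

section \<open>Distances in spire graphs\<close>

text \<open>In the modified graphs \<open>v\<^sub>n\<close> is at least as far from every other vertex as a twin of
  \<open>v\<^bsub>s - 1\<^esub>\<close> adjacent to it would be; this is the only lower bound on distances that is needed.\<close>

definition spire_pos :: "nat \<Rightarrow> nat \<Rightarrow> nat \<Rightarrow> int" where
  "spire_pos n s v = (if v = n then int s - 1 else int v)"

text \<open>Sufficient for a radio labeling with labels up to \<open>K\<close> in all the graphs at
  once. The \<open>max 1\<close> covers the vertices \<open>n\<close> and \<open>s - 1\<close>,
  which share a position but are still at distance at least 1.\<close>

definition pos_labeling :: "nat \<Rightarrow> nat \<Rightarrow> (nat \<Rightarrow> int) \<Rightarrow> int \<Rightarrow> bool" where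
  "pos_labeling n s c K \<longleftrightarrow> (\<forall>u \<in> {1..n}. 1 \<le> c u \<and> c u \<le> K) \<and>
     (\<forall>u \<in> {1..n}. \<forall>v \<in> {1..n}. u \<noteq> v \<longrightarrow>
        max 1 \<bar>spire_pos n s u - spire_pos n s v\<bar> + \<bar>c u - c v\<bar> \<ge> int n - 1)"

text \<open>The distance in the spire graph itself. Additional edges only shorten distances, so it
  bounds those of all the graphs from above.\<close>

definition spire_dist :: "nat \<Rightarrow> nat \<Rightarrow> nat \<Rightarrow> nat \<Rightarrow> int" where
  "spire_dist n s u v =
     (if u = v then 0
      else if u = n then \<bar>int v - int s\<bar> + 1
      else if v = n then \<bar>int u - int s\<bar> + 1
      else \<bar>int u - int v\<bar>)"

section \<open>Walks of a given length\<close>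

definition reach :: "'a graph \<Rightarrow> nat \<Rightarrow> 'a \<Rightarrow> 'a \<Rightarrow> bool" where
  "reach G k u v \<longleftrightarrow> (\<exists>p. walk G p \<and> hd p = u \<and> last p = v \<and> length p = Suc k)"

lemma gdist_eq_Least_reach: "gdist G u v = (LEAST k. reach G k u v)"
  unfolding gdist_def reach_def ..

lemma gdist_le: "reach G k u v \<Longrightarrow> gdist G u v \<le> k"
  unfolding gdist_eq_Least_reach by (rule Least_le)

lemma reach_gdist: "reach G k u v \<Longrightarrow> reach G (gdist G u v) u v"
  unfolding gdist_eq_Least_reach by (rule LeastI)

lemma reach_refl: "u \<in> verts G \<Longrightarrow> reach G 0 u u"
  unfolding reach_def walk_def by (intro exI[of _ "[u]"]) auto

lemma reach_step:
  assumes "reach G k u v" "{v, w} \<in> edges G" "w \<in> verts G"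
  shows "reach G (Suc k) u w"
proof -
  obtain p where p: "walk G p" "hd p = u" "last p = v" "length p = Suc k"
    using assms(1) unfolding reach_def by blast
  have ne: "p \<noteq> []" using p(4) by auto
  have "walk G (p @ [w])"
    unfolding walk_def
  proof (intro conjI allI impI)
    show "set (p @ [w]) \<subseteq> verts G" using p(1) assms(3) by (auto simp: walk_def)
    fix i assume i: "Suc i < length (p @ [w])"
    show "{(p @ [w]) ! i, (p @ [w]) ! Suc i} \<in> edges G"
    proof (cases "Suc i < length p")
      case True
      then show ?thesis using p(1) by (auto simp: walk_def nth_append)
    next
      case False
      then have "i = k" using i p(4) by simp
      moreover have "p ! k = v" using p(3,4) ne by (simp add: last_conv_nth)
      ultimately show ?thesis using p(4) assms(2) by (simp add: nth_append)
    qed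
  qed simp
  then show ?thesis unfolding reach_def
    by (intro exI[of _ "p @ [w]"]) (use p ne in auto)
qed

lemma reach_sym: "reach G k u v \<Longrightarrow> reach G k v u"
proof -
  assume "reach G k u v"
  then obtain p where p: "walk G p" "hd p = u" "last p = v" "length p = Suc k"
    unfolding reach_def by blast
  have ne: "p \<noteq> []" using p(4) by auto
  have "walk G (rev p)"
    unfolding walk_def
  proof (intro conjI allI impI)
    show "rev p \<noteq> []" using ne by simp
    show "set (rev p) \<subseteq> verts G" using p(1) by (auto simp: walk_def)
    fix i assume i: "Suc i < length (rev p)"
    have "{p ! (k - Suc i), p ! Suc (k - Suc i)} \<in> edges G"
      using p(1,4) i by (auto simp: walk_def)
    moreover have "Suc (k - Suc i) = k - i" using i p(4) by auto
    ultimately show "{rev p ! i, rev p ! Suc i} \<in> edges G"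
      using i p(4) by (simp add: rev_nth insert_commute)
  qed
  then show ?thesis unfolding reach_def
    by (intro exI[of _ "rev p"]) (use p ne in \<open>auto simp: hd_rev last_rev\<close>)
qed

text \<open>Each of the \<open>k\<close> edges of the walk changes \<open>f\<close> by at most 1.
  Applied to positions, this bounds distances from below.\<close>

lemma reach_lipschitz:
  fixes f :: "'a \<Rightarrow> int"
  assumes "reach G k u v"
    and lip: "\<And>a b. {a, b} \<in> edges G \<Longrightarrow> \<bar>f a - f b\<bar> \<le> 1"
  shows "\<bar>f u - f v\<bar> \<le> int k"
proof -
  obtain p where p: "walk G p" "hd p = u" "last p = v" "length p = Suc k"
    using assms(1) unfolding reach_def by blast
  have ne: "p \<noteq> []" using p(4) by auto
  have "i < length p \<Longrightarrow> \<bar>f (p ! 0) - f (p ! i)\<bar> \<le> int i" for i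
  proof (induction i)
    case (Suc i)
    have "{p ! i, p ! Suc i} \<in> edges G" using p(1) Suc.prems by (simp add: walk_def)
    from lip[OF this] show ?case using Suc by linarith
  qed simp
  from this[of k] show ?thesis
    using p ne by (simp add: hd_conv_nth last_conv_nth)
qed

lemma gdist_pos:
  assumes "reach G k u v" "u \<noteq> v"
  shows "gdist G u v > 0"
proof (rule ccontr)
  assume "\<not> gdist G u v > 0"
  then have "reach G 0 u v" using reach_gdist[OF assms(1)] by simp
  then obtain p where "length p = Suc 0" "hd p = u" "last p = v"
    unfolding reach_def by blast
  then show False using assms(2) by (cases p) auto
qed

text \<open>Sandwiches all four graphs, so that each argument is given once. For
  \<open>s = 2\<close> the pair \<open>{s - 2, n}\<close> is \<open>{0, n}\<close>, where
  \<open>0\<close> is no vertex.\<close>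

definition spire_like :: "nat \<Rightarrow> nat \<Rightarrow> nat graph \<Rightarrow> bool" where
  "spire_like n s G \<longleftrightarrow> verts G = {1..n} \<and> path_edges n \<union> {{s, n}} \<subseteq> edges G \<and>
     edges G \<subseteq> path_edges n \<union> {{s, n}, {s - 1, n}, {s - 2, n}}"

section \<open>Distances and diameter in this class\<close>

context
  fixes n s :: nat and G :: "nat graph"
  assumes n: "n \<ge> 4" and s: "2 \<le> s" "s \<le> n div 2" and G: "spire_like n s G"
begin

lemma reach_path:
  assumes "1 \<le> u" "u + k \<le> n - 1"
  shows "reach G k u (u + k)"
  using assms(2)
proof (induction k)
  case 0
  then show ?case using assms(1) G by (auto intro!: reach_refl simp: spire_like_def)
next
  case (Suc k)
  then have "{u + k, u + k + 1} \<in> path_edges n"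
    unfolding path_edges_def using assms(1) by (intro CollectI exI[of _ "u + k"]) auto
  then have "{u + k, u + k + 1} \<in> edges G" using G by (auto simp: spire_like_def)
  moreover have "u + k + 1 \<in> verts G" using Suc.prems G by (auto simp: spire_like_def)
  ultimately show ?case using reach_step[of G k u "u + k"] Suc by auto
qed

lemma reach_path_dist:
  assumes "u \<in> {1..n-1}" "v \<in> {1..n-1}"
  shows "reach G (nat \<bar>int u - int v\<bar>) u v"
proof (cases "u \<le> v")
  case True
  then have "nat \<bar>int u - int v\<bar> = v - u" by simp
  then show ?thesis using reach_path[of u "v - u"] True assms by simp
next
  case False
  then have "nat \<bar>int u - int v\<bar> = u - v" by simp
  then show ?thesis using reach_path[of v "u - v"] False assms by (simp add: reach_sym)
qed

lemma reach_spire_dist: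
  assumes "u \<in> {1..n}" "v \<in> {1..n}"
  shows "reach G (nat (spire_dist n s u v)) u v"
proof -
  have V: "verts G = {1..n}" and e: "{s, n} \<in> edges G"
    using G by (auto simp: spire_like_def)
  have to_n: "reach G (nat (\<bar>int w - int s\<bar> + 1)) w n" if "w \<in> {1..n}" "w \<noteq> n" for w
  proof -
    have "reach G (nat \<bar>int w - int s\<bar>) w s"
      using that n s by (intro reach_path_dist) auto
    from reach_step[OF this e] show ?thesis using V n by (simp add: nat_add_distrib)
  qed
  consider "u = v" | "u \<noteq> v" "u = n" | "u \<noteq> v" "v = n" | "u \<noteq> v" "u \<noteq> n" "v \<noteq> n" by blast
  then show ?thesis
  proof cases
    case 1
    then show ?thesis using reach_refl[of u G] V assms by (simp add: spire_dist_def)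
  next
    case 2
    then show ?thesis using reach_sym[OF to_n[of v]] assms by (simp add: spire_dist_def)
  next
    case 3
    then show ?thesis using to_n[of u] assms by (simp add: spire_dist_def)
  next
    case 4
    then have "u \<in> {1..n-1}" "v \<in> {1..n-1}" using assms by auto
    from reach_path_dist[OF this] show ?thesis using 4 by (simp add: spire_dist_def)
  qed
qed

lemma gdist_le_spire_dist:
  assumes "u \<in> {1..n}" "v \<in> {1..n}"
  shows "int (gdist G u v) \<le> spire_dist n s u v"
proof -
  have "spire_dist n s u v \<ge> 0" by (simp add: spire_dist_def)
  then show ?thesis using gdist_le[OF reach_spire_dist[OF assms]] by linarith
qed

text \<open>The extreme pairs involving \<open>n\<close> give \<open>n - s\<close> and
  \<open>s\<close>, both at most \<open>n - 2\<close> in the given range of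
  \<open>s\<close>.\<close>

lemma spire_dist_le:
  assumes "u \<in> {1..n}" "v \<in> {1..n}"
  shows "spire_dist n s u v \<le> int n - 2"
  using assms n s unfolding spire_dist_def by auto

text \<open>Position \<open>s - 1\<close> of the vertex \<open>n\<close> is within 1 of
  \<open>s\<close>, \<open>s - 1\<close> and \<open>s - 2\<close>, so \<open>spire_pos\<close> is
  1-Lipschitz on every permitted edge, even on \<open>{0, n}\<close> when
  \<open>s = 2\<close>.\<close>

lemma gdist_ge_spire_pos:
  assumes "u \<in> {1..n}" "v \<in> {1..n}"
  shows "int (gdist G u v) \<ge> \<bar>spire_pos n s u - spire_pos n s v\<bar>"
proof (rule reach_lipschitz[OF reach_gdist[OF reach_spire_dist[OF assms]]])
  fix a b assume "{a, b} \<in> edges G"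
  then have "{a, b} \<in> path_edges n \<union> {{s, n}, {s - 1, n}, {s - 2, n}}"
    using G by (auto simp: spire_like_def)
  then consider i where "{a, b} = {i, i + 1}" "1 \<le> i" "i \<le> n - 2"
    | i where "{a, b} = {i, n}" "i \<in> {s, s - 1, s - 2}"
    unfolding path_edges_def by blast
  then show "\<bar>spire_pos n s a - spire_pos n s b\<bar> \<le> 1"
  proof cases
    case 1
    then show ?thesis using n s by (auto simp: doubleton_eq_iff spire_pos_def)
  next
    case 2
    then show ?thesis using n s by (auto simp: doubleton_eq_iff spire_pos_def)
  qed
qed

lemma diam_spire_like: "int (diam G) = int n - 2"
proof -
  let ?S = "{gdist G u v | u v. u \<in> verts G \<and> v \<in> verts G}"
  have V: "verts G = {1..n}" using G by (simp add: spire_like_def)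
  have fin: "finite ?S" unfolding V by (rule finite_image_set2) auto
  have "diam G \<in> ?S" unfolding diam_def
    by (rule Max_in[OF fin]) (use V n in \<open>auto intro!: exI[of _ 1]\<close>)
  then obtain u v where "u \<in> {1..n}" "v \<in> {1..n}" "diam G = gdist G u v" using V by auto
  then have "int (diam G) \<le> int n - 2"
    using gdist_le_spire_dist[of u v] spire_dist_le[of u v] by linarith
  moreover have "gdist G 1 (n - 1) \<le> diam G" unfolding diam_def
    by (rule Max_ge[OF fin], unfold V, intro CollectI exI[of _ 1] exI[of _ "n - 1"]) (use n in auto)
  moreover have "int n - 2 \<le> int (gdist G 1 (n - 1))"
  proof -
    have "1 \<in> {1..n}" "n - 1 \<in> {1..n}" using n by auto
    from gdist_ge_spire_pos[OF this] show ?thesis using n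
      by (auto simp: spire_pos_def of_nat_diff split: if_splits)
  qed
  ultimately show ?thesis by linarith
qed

text \<open>Reduces the radio number to two tasks that do not mention \<open>G\<close>. Radio
  labelings of \<open>G\<close> satisfy the premises of \<open>lower\<close> because
  \<open>spire_dist\<close> dominates the distance.\<close>

lemma rn_spire_like_eqI:
  assumes labeling: "pos_labeling n s c K"
    and lower: "\<And>c. (\<And>u. u \<in> {1..n} \<Longrightarrow> 1 \<le> c u) \<Longrightarrow>
        (\<And>u v. u \<in> {1..n} \<Longrightarrow> v \<in> {1..n} \<Longrightarrow> u \<noteq> v \<Longrightarrow>
          spire_dist n s u v + \<bar>c u - c v\<bar> \<ge> int n - 1) \<Longrightarrow>
        \<exists>v \<in> {1..n}. K \<le> c v"
  shows "int (rn G) = K"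
proof -
  have V: "verts G = {1..n}" using G by (simp add: spire_like_def)
  have ne: "{1..n} \<noteq> {}" using n by auto
  have upper: "\<And>u. u \<in> {1..n} \<Longrightarrow> 1 \<le> c u \<and> c u \<le> K"
      "\<And>u v. u \<in> {1..n} \<Longrightarrow> v \<in> {1..n} \<Longrightarrow> u \<noteq> v \<Longrightarrow>
        max 1 \<bar>spire_pos n s u - spire_pos n s v\<bar> + \<bar>c u - c v\<bar> \<ge> int n - 1"
    using labeling unfolding pos_labeling_def by blast+
  have lab: "radio_labeling G c"
    unfolding radio_labeling_def V diam_spire_like
  proof (intro conjI ballI impI)
    fix u assume "u \<in> {1..n}" then show "c u > 0" using upper(1)[of u] by linarith
  next
    fix u v assume uv: "u \<in> {1..n}" "v \<in> {1..n}" "u \<noteq> v"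
    have "gdist G u v \<ge> 1" using gdist_pos[OF reach_spire_dist] uv by (simp add: Suc_le_eq)
    then show "int n - 2 + 1 \<le> int (gdist G u v) + \<bar>c u - c v\<bar>"
      using upper(2)[OF uv] gdist_ge_spire_pos[OF uv(1,2)] by linarith
  qed
  have m: "1 \<le> label_span G c" "label_span G c \<le> K"
    unfolding label_span_def V using upper(1) ne by (auto simp: Max_ge_iff)
  have wit: "radio_labeling G c \<and> label_span G c = int (nat (label_span G c))"
    using lab m by simp
  have "rn G \<le> nat (label_span G c)"
    unfolding rn_def by (rule Least_le) (use wit in blast)
  then have le: "int (rn G) \<le> K" using m by linarith
  have "\<exists>c'. radio_labeling G c' \<and> label_span G c' = int (rn G)"
    unfolding rn_def by (rule LeastI[of _ "nat (label_span G c)"]) (use wit in blast)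
  then obtain c' where c': "radio_labeling G c'" "label_span G c' = int (rn G)" by blast
  have "\<exists>v \<in> {1..n}. K \<le> c' v"
  proof (rule lower)
    fix u assume "u \<in> {1..n}"
    then have "0 < c' u" using c'(1) unfolding radio_labeling_def V by blast
    then show "1 \<le> c' u" by simp
  next
    fix u v assume uv: "u \<in> {1..n}" "v \<in> {1..n}" "u \<noteq> v"
    then have "int n - 2 + 1 \<le> int (gdist G u v) + \<bar>c' u - c' v\<bar>"
      using c'(1) unfolding radio_labeling_def V diam_spire_like by blast
    then show "int n - 1 \<le> spire_dist n s u v + \<bar>c' u - c' v\<bar>"
      using gdist_le_spire_dist[OF uv(1,2)] by linarith
  qed
  then have "K \<le> label_span G c'"
    unfolding label_span_def V by (subst Max_ge_iff) auto
  then show ?thesis using le c'(2) by simp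
qed

end

section \<open>The lower bound\<close>

text \<open>For even \<open>n\<close> the last summand is half the least sum of end weights and
  excesses that the lower bound forces, rounded up.\<close>

definition spire_rn :: "nat \<Rightarrow> nat \<Rightarrow> int" where
  "spire_rn n s = (let k = int (n div 2) in
     if odd n then 2 * k\<^sup>2 - 2 * k + 2 * int s
     else 2 * k\<^sup>2 - 4 * k + 2 * int s +
       (if int s = k then 1 else if int s = k - 1 then 2 else 3))"

lemma sum_abs_below:
  assumes "2 * int m \<le> b"
  shows "(\<Sum>i = 1..m. \<bar>2 * int i - b\<bar>) = int m * b - int m * (int m + 1)"
  using assms by (induction m) (auto simp: algebra_simps)

text \<open>The sign inside the absolute value changes after index \<open>a\<close>, so the
  induction starts at \<open>m = a\<close> from the previous sum.\<close>

lemma sum_abs_above: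
  assumes "a \<le> m" "2 * int a \<le> b" "b \<le> 2 * int a + 2"
  shows "(\<Sum>i = 1..m. \<bar>2 * int i - b\<bar>) =
    int m * (int m + 1) - int m * b + 2 * (int a * b - int a * (int a + 1))"
  using assms(1)
proof (induction m rule: dec_induct)
  case base
  then show ?case using sum_abs_below[OF assms(2)] by (simp add: algebra_simps)
next
  case (step m)
  then show ?case using assms by (simp add: algebra_simps)
qed

lemma sorted_enumeration:
  fixes c :: "'a \<Rightarrow> int"
  assumes "finite A"
  obtains x where "bij_betw x {..<card A} A"
    "\<And>i j. i \<le> j \<Longrightarrow> j < card A \<Longrightarrow> c (x i) \<le> c (x j)"
proof -
  obtain xs where xs: "set xs = A" "distinct xs" using finite_distinct_list[OF assms] by blast
  let ?ys = "sort_key c xs"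
  have len: "length ?ys = card A" using xs distinct_card by force
  show thesis
  proof
    show "bij_betw ((!) ?ys) {..<card A} A"
      by (rule bij_betw_nth) (use xs len in auto)
    fix i j assume "i \<le> j" "j < card A"
    then show "c (?ys ! i) \<le> c (?ys ! j)"
      using sorted_nth_mono[OF sorted_sort_key[of c xs], of i j] len by simp
  qed
qed

text \<open>\<open>W\<close> stays abstract because two centres are used, a vertex and the midpoint
  of an edge. The last assumption is the triangle inequality through the centre.\<close>

locale ordered_labeling =
  fixes n s :: nat and c :: "nat \<Rightarrow> int" and x :: "nat \<Rightarrow> nat" and W :: "nat \<Rightarrow> int"
  assumes n: "n \<ge> 4" and s: "2 \<le> s" "s \<le> n div 2"
    and bij: "bij_betw x {..<n} {1..n}"
    and mono: "\<And>i j. i \<le> j \<Longrightarrow> j < n \<Longrightarrow> c (x i) \<le> c (x j)"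
    and radio: "\<And>u v. u \<in> {1..n} \<Longrightarrow> v \<in> {1..n} \<Longrightarrow> u \<noteq> v \<Longrightarrow>
        spire_dist n s u v + \<bar>c u - c v\<bar> \<ge> int n - 1"
    and weight: "\<And>u v. u \<in> {1..n} \<Longrightarrow> v \<in> {1..n} \<Longrightarrow> u \<noteq> v \<Longrightarrow>
        2 * spire_dist n s u v \<le> W u + W v"
begin

text \<open>Twice the amount by which a label step exceeds \<open>n - 1\<close> minus half the two
  weights; doubling avoids halves, as weights may be odd.\<close>

definition excess :: "nat \<Rightarrow> int" where
  "excess i = 2 * (c (x (Suc i)) - c (x i)) - 2 * (int n - 1) + W (x i) + W (x (Suc i))"

lemma x_mem: "i < n \<Longrightarrow> x i \<in> {1..n}"
  using bij by (auto simp: bij_betw_def)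

lemma x_inj: "i < n \<Longrightarrow> j < n \<Longrightarrow> x i = x j \<longleftrightarrow> i = j"
  using bij by (auto simp: bij_betw_def inj_on_def)

lemma x_surj: "v \<in> {1..n} \<Longrightarrow> \<exists>i<n. x i = v"
  using bij unfolding bij_betw_def by (metis imageE lessThan_iff)

lemma gap: "i < j \<Longrightarrow> j < n \<Longrightarrow> c (x j) - c (x i) \<ge> int n - 1 - spire_dist n s (x i) (x j)"
  using radio[of "x i" "x j"] mono[of i j] x_mem[of i] x_mem[of j] x_inj[of i j] by simp

lemma excess_ge:
  "Suc i < n \<Longrightarrow> W (x i) + W (x (Suc i)) - 2 * spire_dist n s (x i) (x (Suc i)) \<le> excess i"
  using gap[of i "Suc i"] by (simp add: excess_def)

lemma excess_nonneg: "Suc i < n \<Longrightarrow> 0 \<le> excess i"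
  using excess_ge[of i] weight[of "x i" "x (Suc i)"] x_mem[of i] x_mem[of "Suc i"] x_inj[of i "Suc i"]
  by simp

text \<open>The radio condition between the outer two of three consecutive vertices. The middle
  weight enters both excesses, so a heavy middle vertex forces excess.\<close>

lemma excess_pair_ge:
  assumes "Suc (Suc i) < n"
  shows "W (x i) + 2 * W (x (Suc i)) + W (x (Suc (Suc i))) - 2 * (int n - 1)
    - 2 * spire_dist n s (x i) (x (Suc (Suc i))) \<le> excess i + excess (Suc i)"
  using gap[of i "Suc (Suc i)"] assms by (simp add: excess_def)

lemma sum_weights: "(\<Sum>i<n. W (x i)) = (\<Sum>v = 1..n. W v)"
  by (rule sum.reindex_bij_betw[OF bij])

text \<open>The label steps telescope; every weight is counted twice except those of the two
  ends.\<close>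

lemma span_eq:
  "2 * (c (x (n - 1)) - c (x 0)) = 2 * (int n - 1)\<^sup>2 - 2 * (\<Sum>v = 1..n. W v)
     + W (x 0) + W (x (n - 1)) + (\<Sum>i<n - 1. excess i)"
proof -
  have "(\<Sum>i<m. excess i) = 2 * (c (x m) - c (x 0)) - 2 * (int n - 1) * int m
      + 2 * (\<Sum>i<Suc m. W (x i)) - W (x 0) - W (x m)" for m
    by (induction m) (auto simp: excess_def algebra_simps)
  from this[of "n - 1"] n show ?thesis
    unfolding sum_weights[symmetric] by (simp add: of_nat_diff power2_eq_square algebra_simps)
qed

lemma sum_excess_ge:
  assumes "I \<subseteq> {..<n - 1}"
  shows "sum excess I \<le> (\<Sum>i<n - 1. excess i)"
  by (rule sum_mono2) (use assms excess_nonneg in auto)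

end

text \<open>The weight is twice the distance to \<open>v\<^bsub>n div 2\<^esub>\<close>.\<close>

lemma spire_lower_central:
  fixes n s :: nat
  assumes n: "n \<ge> 4" and s: "2 \<le> s" "s \<le> n div 2" and cse: "odd n \<or> s = n div 2"
    and pos: "\<And>u. u \<in> {1..n} \<Longrightarrow> 1 \<le> c u"
    and radio: "\<And>u v. u \<in> {1..n} \<Longrightarrow> v \<in> {1..n} \<Longrightarrow> u \<noteq> v \<Longrightarrow>
          spire_dist n s u v + \<bar>c u - c v\<bar> \<ge> int n - 1"
  shows "\<exists>v \<in> {1..n}. spire_rn n s \<le> c v"
proof -
  define k where "k = n div 2"
  define W :: "nat \<Rightarrow> int" where
    "W v = (if v = n then 2 * (int k - int s + 1) else \<bar>2 * int v - 2 * int k\<bar>)" for v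
  obtain x where x: "bij_betw x {..<n} {1..n}"
    "\<And>i j. i \<le> j \<Longrightarrow> j < n \<Longrightarrow> c (x i) \<le> c (x j)"
    using sorted_enumeration[of "{1..n}" c] by auto
  interpret ordered_labeling n s c x W
  proof
    fix u v assume "u \<in> {1..n}" "v \<in> {1..n}" "u \<noteq> v"
    then show "2 * spire_dist n s u v \<le> W u + W v"
      using s unfolding W_def spire_dist_def k_def[symmetric] by (auto simp: abs_if)
  qed (use n s x radio in auto)
  have "(\<Sum>v = 1..n. W v) = (\<Sum>v = 1..n - 1. \<bar>2 * int v - 2 * int k\<bar>) + W n"
  proof -
    have "{1..n} = insert n {1..n - 1}" using n by auto
    moreover have "n \<notin> {1..n - 1}" using n by auto
    ultimately have "(\<Sum>v = 1..n. W v) = W n + (\<Sum>v = 1..n - 1. W v)" by simp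
    moreover have "(\<Sum>v = 1..n - 1. W v) = (\<Sum>v = 1..n - 1. \<bar>2 * int v - 2 * int k\<bar>)"
      by (rule sum.cong) (use n in \<open>auto simp: W_def\<close>)
    ultimately show ?thesis by simp
  qed
  also have "(\<Sum>v = 1..n - 1. \<bar>2 * int v - 2 * int k\<bar>) =
      int (n - 1) * (int (n - 1) + 1) - int (n - 1) * (2 * int k) + 2 * (int k * (2 * int k) - int k * (int k + 1))"
    by (rule sum_abs_above) (use n k_def in auto)
  finally have sumW: "(\<Sum>v = 1..n. W v) =
      (int n - 1) * int n - (int n - 1) * (2 * int k) + 2 * (int k * int k - int k) + 2 * (int k - int s + 1)"
    using n by (simp add: of_nat_diff algebra_simps W_def)
  have W_pos: "W (x i) \<ge> 0" "x i \<noteq> k \<Longrightarrow> W (x i) \<ge> 2" for i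
    using s unfolding W_def k_def by auto
  \<comment> \<open>The ends are distinct, and only the vertex \<open>k\<close> has weight below
    2.\<close>
  have "W (x 0) + W (x (n - 1)) \<ge> 2"
    using W_pos[of 0] W_pos[of "n - 1"] x_inj[of 0 "n - 1"] n by force
  moreover have "(\<Sum>i<n - 1. excess i) \<ge> 0"
    by (rule sum_nonneg) (use excess_nonneg in auto)
  ultimately have "2 * (int n - 1)\<^sup>2 - 2 * (\<Sum>v = 1..n. W v) + 2 \<le> 2 * (c (x (n - 1)) - c (x 0))"
    unfolding span_eq by linarith
  then have le: "(int n - 1)\<^sup>2 - (\<Sum>v = 1..n. W v) + 2 \<le> c (x (n - 1))"
    using pos[OF x_mem[of 0]] n by simp
  have "spire_rn n s \<le> c (x (n - 1))"
  proof (cases "odd n")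
    case True
    then have "int n = 2 * int k + 1" unfolding k_def by presburger
    then show ?thesis using le True unfolding sumW spire_rn_def Let_def k_def[symmetric]
      by (simp add: power2_eq_square algebra_simps)
  next
    case False
    then have "int n = 2 * int k" unfolding k_def by presburger
    then show ?thesis using le False cse unfolding sumW spire_rn_def Let_def k_def[symmetric]
      by (simp add: power2_eq_square algebra_simps)
  qed
  then show ?thesis using x_mem[of "n - 1"] n by (intro bexI[of _ "x (n - 1)"]) auto
qed

text \<open>Here the weight is twice the distance to the midpoint of the edge between \<open>v\<^bsub>k - 1\<^esub>\<close> and
  \<open>v\<^sub>k\<close>, so that no vertex has weight zero and \<open>left\<close> and its complement both have \<open>k\<close> vertices.\<close>

locale even_order = ordered_labeling n s c x W
  for n s c x W +
  fixes k :: nat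
  assumes n_eq: "n = 2 * k" and k: "s < k"
    and W_eq: "\<And>v. W v = (if v = n then 2 * int k - 2 * int s + 1 else \<bar>2 * int v - 2 * int k + 1\<bar>)"
begin

definition left :: "nat \<Rightarrow> bool" where
  "left v \<longleftrightarrow> v < k \<or> v = n"

text \<open>The route through the centre runs over a shared stretch twice. For two path vertices the
  surplus is twice the smaller weight; for \<open>n\<close> and a vertex up to \<open>s\<close> it
  is \<open>2 * (2 * k - 2 * s - 1)\<close>, hence the condition on \<open>k - s\<close>.\<close>

lemma same_side:
  assumes "u \<in> {1..n}" "v \<in> {1..n}" "u \<noteq> v" "left u = left v"
  shows "W u + W v - 2 * spire_dist n s u v \<ge> 2"
    and "int k - int s \<ge> 2 \<Longrightarrow> W u \<ge> 3 \<Longrightarrow> W v \<ge> 3 \<Longrightarrow> W u + W v - 2 * spire_dist n s u v \<ge> 6"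
  using assms n s k n_eq unfolding W_eq left_def spire_dist_def
  by (auto simp: abs_if split: if_splits)

lemma W_ge: "v \<in> {1..n} \<Longrightarrow> W v \<ge> 1"
  and W_ge_3: "v \<in> {1..n} \<Longrightarrow> v \<noteq> k \<Longrightarrow> v \<noteq> k - 1 \<Longrightarrow> W v \<ge> 3"
  using k s unfolding W_eq by (simp, presburger, simp, presburger)

lemma excess_same_side:
  assumes "Suc i < n" "left (x i) = left (x (Suc i))"
  shows "2 \<le> excess i"
    and "int k - int s \<ge> 2 \<Longrightarrow> W (x i) \<ge> 3 \<Longrightarrow> W (x (Suc i)) \<ge> 3 \<Longrightarrow> 6 \<le> excess i"
  using same_side[of "x i" "x (Suc i)"] excess_ge[of i] x_mem[of i] x_mem[of "Suc i"]
    x_inj[of i "Suc i"] assms by auto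

text \<open>A step within one side has excess at least 2, so each step of excess zero changes
  sides.\<close>

lemma alternate:
  assumes "a + m < n" "\<And>i. a \<le> i \<Longrightarrow> i < a + m \<Longrightarrow> excess i = 0"
  shows "left (x (a + m)) \<longleftrightarrow> (left (x a) \<longleftrightarrow> even m)"
  using assms
proof (induction m)
  case (Suc m)
  then show ?case using excess_same_side(1)[of "a + m"] by force
qed simp

text \<open>The right end of the path has weight \<open>n - 1\<close>, which cancels
  \<open>2 * (n - 1)\<close> in the pair bound. Two left neighbours then leave their same-side
  surplus; a right neighbour makes a same-side step.\<close>

lemma excess_around_last:
  assumes "Suc (Suc i) < n" "x (Suc i) = 2 * k - 1"
  shows "2 \<le> excess i + excess (Suc i)"
    and "left (x i) \<Longrightarrow> left (x (Suc (Suc i))) \<Longrightarrow> int k - int s \<ge> 2 \<Longrightarrow>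
      W (x i) \<ge> 3 \<Longrightarrow> W (x (Suc (Suc i))) \<ge> 3 \<Longrightarrow> 6 \<le> excess i + excess (Suc i)"
proof -
  have r: "\<not> left (x (Suc i))" and w: "W (x (Suc i)) = 2 * int k - 1"
    unfolding assms(2) left_def W_eq using n_eq k by auto
  have nn: "excess i \<ge> 0" "excess (Suc i) \<ge> 0" using excess_nonneg assms(1) by auto
  have m: "x i \<in> {1..n}" "x (Suc (Suc i)) \<in> {1..n}" "x i \<noteq> x (Suc (Suc i))"
    using x_mem[of i] x_mem[of "Suc (Suc i)"] x_inj[of i "Suc (Suc i)"] assms(1) by auto
  note p = excess_pair_ge[OF assms(1)]
  show "2 \<le> excess i + excess (Suc i)"
  proof (cases "left (x i) \<and> left (x (Suc (Suc i)))")
    case True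
    then show ?thesis using p w same_side(1)[OF m] n_eq by auto
  next
    case False
    then show ?thesis using excess_same_side(1)[of i] excess_same_side(1)[of "Suc i"] r nn assms(1)
      by force
  qed
  assume "left (x i)" "left (x (Suc (Suc i)))" "int k - int s \<ge> 2" "W (x i) \<ge> 3"
    "W (x (Suc (Suc i))) \<ge> 3"
  then show "6 \<le> excess i + excess (Suc i)" using p w same_side(2)[OF m] n_eq by auto
qed

lemma inner_position:
  assumes "v \<in> {1..n}" "x 0 \<noteq> v" "x (n - 1) \<noteq> v"
  obtains i where "Suc (Suc i) < n" "x (Suc i) = v"
proof -
  obtain j where "j < n" "x j = v" using x_surj[OF assms(1)] by blast
  moreover have "j \<noteq> 0" "j \<noteq> n - 1" using calculation assms(2,3) by metis+
  ultimately show thesis using that[of "j - 1"] by auto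
qed

text \<open>Either \<open>2 * k - 1\<close> is an end of the order, with weight at least 5, or it is
  inner and the steps around it add 2 to the end weights.\<close>

lemma weak_bound: "4 \<le> W (x 0) + W (x (n - 1)) + (\<Sum>i<n - 1. excess i)"
proof (cases "x 0 = 2 * k - 1 \<or> x (n - 1) = 2 * k - 1")
  case True
  moreover have "W (2 * k - 1) \<ge> 5" using k s n_eq by (auto simp: W_eq)
  ultimately have "W (x 0) + W (x (n - 1)) \<ge> 5"
    using W_ge[OF x_mem[of 0]] W_ge[OF x_mem[of "n - 1"]] n by auto
  moreover have "(\<Sum>i<n - 1. excess i) \<ge> 0" by (rule sum_nonneg) (use excess_nonneg in auto)
  ultimately show ?thesis by linarith
next
  case False
  moreover have "2 * k - 1 \<in> {1..n}" using n_eq k by auto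
  ultimately obtain i where i: "Suc (Suc i) < n" "x (Suc i) = 2 * k - 1"
    using inner_position by metis
  have "sum excess {i, Suc i} \<le> (\<Sum>i<n - 1. excess i)" by (rule sum_excess_ge) (use i in auto)
  then show ?thesis
    using W_ge[OF x_mem[of 0]] W_ge[OF x_mem[of "n - 1"]] n excess_around_last(1)[OF i] by simp
qed

text \<open>Equality would leave a total excess of two, all of it next to \<open>v\<^bsub>2k - 1\<^esub>\<close>. This forces the
  order to start and end with \<open>v\<^bsub>k - 1\<^esub>\<close> (next to \<open>v\<^bsub>2k - 2\<^esub>\<close>) and \<open>v\<^sub>k\<close> (next to
  \<open>v\<^bsub>2k - 1\<^esub>\<close>) and to alternate between the sides elsewhere, which is impossible as \<open>n\<close> is even.\<close>

lemma strong_bound: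
  assumes gap2: "s + 2 \<le> k"
  shows "4 < W (x 0) + W (x (n - 1)) + (\<Sum>i<n - 1. excess i)"
proof (rule ccontr)
  assume "\<not> ?thesis"
  then have total: "W (x 0) + W (x (n - 1)) + (\<Sum>i<n - 1. excess i) \<le> 4" by simp
  have ks: "int k - int s \<ge> 2" "k \<ge> 4" using gap2 s by auto
  have m0: "x 0 \<in> {1..n}" "x (n - 1) \<in> {1..n}" using x_mem n by auto
  have ends_ne: "x 0 \<noteq> x (n - 1)" using x_inj[of 0 "n - 1"] n by simp
  have W_ends: "W (x 0) \<ge> 1" "W (x (n - 1)) \<ge> 1" using W_ge m0 by auto
  have sum_nonneg: "(\<Sum>i<n - 1. excess i) \<ge> 0" by (rule sum_nonneg) (use excess_nonneg in auto)
  \<comment> \<open>An end of weight 4 or more would push the total above 4, as the other end weighs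
    at least 1.\<close>
  have inner: "\<exists>i. Suc (Suc i) < n \<and> x (Suc i) = v" if "v \<in> {1..n}" "W v \<ge> 4" for v
  proof -
    have "x 0 \<noteq> v" "x (n - 1) \<noteq> v" using that(2) total W_ends sum_nonneg by auto
    then show ?thesis using inner_position[OF that(1)] by metis
  qed
  have v1: "2 * k - 1 \<in> {1..n}" "W (2 * k - 1) = 2 * int k - 1"
    and v2: "2 * k - 2 \<in> {1..n}" "W (2 * k - 2) = 2 * int k - 3"
    using n_eq ks(2) by (auto simp: W_eq of_nat_diff)
  obtain t where t: "Suc (Suc t) < n" "x (Suc t) = 2 * k - 1" using inner v1 ks by fastforce
  obtain q where q: "Suc (Suc q) < n" "x (Suc q) = 2 * k - 2" using inner v2 ks by fastforce
  have around_t: "excess t + excess (Suc t) \<ge> 2" by (rule excess_around_last(1)[OF t])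
  have "sum excess {t, Suc t} \<le> (\<Sum>i<n - 1. excess i)" by (rule sum_excess_ge) (use t in auto)
  \<comment> \<open>The minimal contributions 1, 1 and 2 already exhaust the total of 4.\<close>
  then have W_ends_eq: "W (x 0) = 1" "W (x (n - 1)) = 1" and t_eq: "excess t + excess (Suc t) = 2"
    using around_t total W_ends by auto
  have ends: "x 0 \<in> {k - 1, k}" "x (n - 1) \<in> {k - 1, k}"
    using W_ge_3 m0 W_ends_eq by force+
  have zero: "excess i = 0" if "Suc i < n" "i \<noteq> t" "i \<noteq> Suc t" for i
  proof -
    have "sum excess {t, Suc t, i} \<le> (\<Sum>i<n - 1. excess i)"
      by (rule sum_excess_ge) (use that t in auto)
    then show ?thesis using total W_ends t_eq that excess_nonneg[of i] by simp
  qed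
  have left_k: "\<not> left k" "left (k - 1)" "\<not> left (2 * k - 1)" "\<not> left (2 * k - 2)"
    unfolding left_def using n_eq ks by auto
  have W_inner: "W (x i) \<ge> 3" if "0 < i" "i < n - 1" for i
  proof -
    have "x i \<noteq> x 0" "x i \<noteq> x (n - 1)" using x_inj[of i 0] x_inj[of i "n - 1"] that by auto
    then have "x i \<noteq> k" "x i \<noteq> k - 1" using ends ends_ne by auto
    then show ?thesis using W_ge_3[OF x_mem] that by simp
  qed
  have qt: "q \<noteq> t" using q t ks by auto
  \<comment> \<open>If \<open>2 * k - 2\<close> and \<open>2 * k - 1\<close> were consecutive, two
    heavy vertices of one side would give an excess of 6.\<close>
  have far: "q \<noteq> Suc t" "t \<noteq> Suc q"
  proof -
    have "excess t \<le> 2" "excess (Suc t) \<le> 2"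
      using t_eq excess_nonneg[of t] excess_nonneg[of "Suc t"] t by auto
    then show "q \<noteq> Suc t" "t \<noteq> Suc q"
      using excess_same_side(2)[of "Suc t"] excess_same_side(2)[of "Suc q"] left_k q t v1 v2 ks by auto
  qed
  have q_zero: "excess q = 0" "excess (Suc q) = 0" using zero q t qt far by auto
  have q_left: "left (x q)" "left (x (Suc (Suc q)))"
    using excess_same_side(1)[of q] excess_same_side(1)[of "Suc q"] q_zero q left_k by force+
  \<comment> \<open>The weight \<open>n - 3\<close> of \<open>2 * k - 2\<close> costs 4 in the pair
    bound. Two heavy left neighbours would have surplus 6, leaving excess 2 where it is
    zero.\<close>
  have q_end: "q = 0 \<or> Suc (Suc q) = n - 1"
  proof (rule ccontr)
    assume "\<not> ?thesis"
    then have "W (x q) \<ge> 3" "W (x (Suc (Suc q))) \<ge> 3" using W_inner q by auto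
    then have "W (x q) + W (x (Suc (Suc q))) - 2 * spire_dist n s (x q) (x (Suc (Suc q))) \<ge> 6"
      using same_side(2)[OF x_mem x_mem, of q "Suc (Suc q)"] x_inj[of q "Suc (Suc q)"] q q_left ks by simp
    then show False using excess_pair_ge[OF q(1)] q_zero q(2) v2 n_eq by simp
  qed
  \<comment> \<open>With two heavy neighbours of \<open>2 * k - 1\<close> the excess is at least 6,
    around it if both are left and in a single step otherwise.\<close>
  have t_end: "t = 0 \<or> Suc (Suc t) = n - 1"
  proof (rule ccontr)
    assume "\<not> ?thesis"
    then have w: "W (x t) \<ge> 3" "W (x (Suc (Suc t))) \<ge> 3" using W_inner t by auto
    have "\<not> left (x t) \<or> \<not> left (x (Suc (Suc t)))"
      using excess_around_last(2)[OF t] w ks t_eq by auto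
    then show False
      using excess_same_side(2)[of t] excess_same_side(2)[of "Suc t"] w ks t v1 left_k t_eq
        excess_nonneg[of t] excess_nonneg[of "Suc t"] by auto
  qed
  show False
  proof (cases "q = 0")
    case True
    then have tn: "Suc (Suc t) = n - 1" using t_end qt by auto
    have x0: "x 0 = k - 1" using q_left True ends left_k by auto
    then have xl: "\<not> left (x (n - 1))" using ends ends_ne left_k by auto
    \<comment> \<open>Alternation over an odd number of steps puts \<open>x t\<close> on the right,
      and \<open>x (n - 1)\<close> is there too. Both steps around \<open>2 * k - 1\<close> then
      have excess 2, but their sum is 2.\<close>
    have "left (x (0 + t)) \<longleftrightarrow> (left (x 0) \<longleftrightarrow> even t)"
      by (rule alternate) (use t zero in auto)
    moreover have "odd t" using tn n_eq by presburger
    ultimately have "\<not> left (x t)" using x0 left_k by simp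
    then show False
      using excess_same_side(1)[of t] excess_same_side(1)[of "Suc t"] t left_k xl tn t_eq by auto
  next
    case False
    then have qn: "Suc (Suc q) = n - 1" and t0: "t = 0" using q_end t_end qt by auto
    have xl: "x (n - 1) = k - 1" using q_left qn ends left_k by auto
    then have x0: "\<not> left (x 0)" using ends ends_ne left_k by auto
    \<comment> \<open>The mirror image: alternation back from the last vertex puts
      \<open>x 2\<close> on the right, like \<open>x 0\<close>.\<close>
    have "left (x (2 + (n - 3))) \<longleftrightarrow> (left (x 2) \<longleftrightarrow> even (n - 3))"
      by (rule alternate) (use t n t0 zero in auto)
    moreover have "odd (n - 3)" "2 + (n - 3) = n - 1" using n n_eq by presburger+
    ultimately have "\<not> left (x 2)" using xl left_k by simp
    then show False
      using excess_same_side(1)[of t] excess_same_side(1)[of "Suc t"] t left_k x0 t0 t_eq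
      by (auto simp: numeral_2_eq_2)
  qed
qed

end

lemma spire_lower_even:
  fixes n s :: nat
  assumes n: "n \<ge> 4" and s: "2 \<le> s" "s < n div 2" and even: "even n"
    and pos: "\<And>u. u \<in> {1..n} \<Longrightarrow> 1 \<le> c u"
    and radio: "\<And>u v. u \<in> {1..n} \<Longrightarrow> v \<in> {1..n} \<Longrightarrow> u \<noteq> v \<Longrightarrow>
          spire_dist n s u v + \<bar>c u - c v\<bar> \<ge> int n - 1"
  shows "\<exists>v \<in> {1..n}. spire_rn n s \<le> c v"
proof -
  define k where "k = n div 2"
  define W :: "nat \<Rightarrow> int" where
    "W v = (if v = n then 2 * int k - 2 * int s + 1 else \<bar>2 * int v - 2 * int k + 1\<bar>)" for v
  have n_eq: "n = 2 * k" and sk: "s < k" using even s by (auto simp: k_def)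
  obtain x where x: "bij_betw x {..<n} {1..n}"
    "\<And>i j. i \<le> j \<Longrightarrow> j < n \<Longrightarrow> c (x i) \<le> c (x j)"
    using sorted_enumeration[of "{1..n}" c] by auto
  interpret even_order n s c x W k
  proof
    fix u v assume "u \<in> {1..n}" "v \<in> {1..n}" "u \<noteq> v"
    then show "2 * spire_dist n s u v \<le> W u + W v"
      using s sk unfolding W_def spire_dist_def by (auto simp: abs_if)
  qed (use n s x radio n_eq sk W_def in auto)
  have "(\<Sum>v = 1..n. W v) = (\<Sum>v = 1..n - 1. \<bar>2 * int v - (2 * int k - 1)\<bar>) + W n"
  proof -
    have "{1..n} = insert n {1..n - 1}" using n by auto
    moreover have "n \<notin> {1..n - 1}" using n by auto
    ultimately have "(\<Sum>v = 1..n. W v) = W n + (\<Sum>v = 1..n - 1. W v)" by simp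
    moreover have "(\<Sum>v = 1..n - 1. W v) = (\<Sum>v = 1..n - 1. \<bar>2 * int v - (2 * int k - 1)\<bar>)"
      by (rule sum.cong) (use n in \<open>auto simp: W_def\<close>)
    ultimately show ?thesis by simp
  qed
  also have "(\<Sum>v = 1..n - 1. \<bar>2 * int v - (2 * int k - 1)\<bar>) =
      int (n - 1) * (int (n - 1) + 1) - int (n - 1) * (2 * int k - 1)
      + 2 * (int (k - 1) * (2 * int k - 1) - int (k - 1) * (int (k - 1) + 1))"
    by (rule sum_abs_above) (use n_eq sk in auto)
  finally have sumW: "(\<Sum>v = 1..n. W v) = 2 * int k * int k - 2 * int s + 2"
    using n_eq sk by (simp add: of_nat_diff algebra_simps W_def)
  define E where "E = W (x 0) + W (x (n - 1)) + (\<Sum>i<n - 1. excess i)"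
  have "2 * (c (x (n - 1)) - c (x 0)) = 2 * (2 * int k - 1)\<^sup>2 - 4 * int k * int k + 4 * int s - 4 + E"
    unfolding span_eq sumW E_def using n_eq by simp
  moreover have "1 \<le> c (x 0)" using pos[OF x_mem[of 0]] n by simp
  ultimately have le: "2 * (2 * (int k)\<^sup>2 - 4 * int k + 2 * int s) + E \<le> 2 * c (x (n - 1))"
    by (simp add: power2_eq_square algebra_simps)
  have E: "E \<ge> 4" "s + 2 \<le> k \<Longrightarrow> E > 4"
    using weak_bound strong_bound unfolding E_def by auto
  \<comment> \<open>Twice a label is even, so \<open>E > 4\<close> counts as 6 and raises the label
    by one more.\<close>
  have "spire_rn n s \<le> c (x (n - 1))"
    using le E sk even unfolding spire_rn_def Let_def k_def[symmetric] by auto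
  then show ?thesis using x_mem[of "n - 1"] n by (intro bexI[of _ "x (n - 1)"]) auto
qed

lemma spire_lower:
  fixes n s :: nat
  assumes "n \<ge> 4" "2 \<le> s" "s \<le> n div 2"
    and "\<And>u. u \<in> {1..n} \<Longrightarrow> 1 \<le> c u"
    and "\<And>u v. u \<in> {1..n} \<Longrightarrow> v \<in> {1..n} \<Longrightarrow> u \<noteq> v \<Longrightarrow>
          spire_dist n s u v + \<bar>c u - c v\<bar> \<ge> int n - 1"
  shows "\<exists>v \<in> {1..n}. spire_rn n s \<le> c v"
proof (cases "odd n \<or> s = n div 2")
  case True
  show ?thesis by (rule spire_lower_central[OF assms(1-3) True assms(4,5)])
next
  case False
  then show ?thesis using spire_lower_even[OF assms(1,2) _ _ assms(4,5)] assms(3) by simp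
qed

section \<open>Optimal labelings\<close>

text \<open>The variables \<open>m\<close> and \<open>d\<close> bound the position and label
  differences, which turns the condition into linear inequalities without \<open>max\<close> or
  absolute values.\<close>

lemma pos_labelingI:
  assumes "\<And>v. v \<in> {1..n} \<Longrightarrow> 1 \<le> c v \<and> c v \<le> K"
    and "\<And>u v m d. u \<in> {1..n} \<Longrightarrow> v \<in> {1..n} \<Longrightarrow> int u \<noteq> int v \<Longrightarrow> 1 \<le> m \<Longrightarrow>
      spire_pos n s u - spire_pos n s v \<le> m \<Longrightarrow> spire_pos n s v - spire_pos n s u \<le> m \<Longrightarrow>
      c u - c v \<le> d \<Longrightarrow> c v - c u \<le> d \<Longrightarrow> int n - 1 \<le> m + d"
  shows "pos_labeling n s c K"
  unfolding pos_labeling_def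
proof (intro conjI ballI impI)
  fix u v assume "u \<in> {1..n}" "v \<in> {1..n}" "u \<noteq> v"
  then show "int n - 1 \<le> max 1 \<bar>spire_pos n s u - spire_pos n s v\<bar> + \<bar>c u - c v\<bar>"
    by (intro assms(2)) auto
qed (use assms(1) in auto)

text \<open>Since \<open>(b - a - 1) * (M - 2) \<ge> 0\<close>. It supplies the linear facts about
  products with \<open>M\<close>, which can then be treated as atoms.\<close>

lemma mult_diff_ge:
  fixes a b M :: int
  assumes "a < b" "2 \<le> M"
  shows "a * M + M + 2 * (b - a - 1) \<le> b * M"
  using mult_left_mono[of 2 M "b - a - 1"] assms by (simp add: algebra_simps)

lemma mult_trichotomy:
  fixes a b M :: int
  assumes "2 \<le> M"
  shows "(a < b \<and> a * M + M + 2 * (b - a - 1) \<le> b * M) \<or>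
    (b < a \<and> b * M + M + 2 * (a - b - 1) \<le> a * M) \<or> (a = b \<and> a * M = b * M)"
  using mult_diff_ge[of a b M] mult_diff_ge[of b a M] assms by (cases a b rule: linorder_cases) auto

text \<open>In the four labelings below, \<open>q v\<close> is the number of the block of the zigzag between the two
  halves of the path in which \<open>v\<close> is visited, and each block adds \<open>M\<close> to the labels. The vertices
  listed explicitly in \<open>c\<close> come before or after the zigzag. Each label step is \<open>n - 1\<close> minus the
  distance, except that for \<open>n = 2k\<close> and \<open>s < k\<close> one step next to \<open>v\<^bsub>2k - 1\<^esub>\<close> is larger by one.\<close>

lemma pos_labeling_odd:
  assumes "k \<ge> 2" "2 \<le> s" "s \<le> k"
  shows "\<exists>c. pos_labeling (2 * k + 1) s c (2 * (int k)\<^sup>2 - 2 * int k + 2 * int s)"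
proof -
  define K M N where "K = int k" "M = 2 * K - 1" "N = K - 1"
  define B where "B = N * M"
  note defs = K_M_N_def
  define q where "q v = (if int v < K then K - 1 - int v else 2 * K - 1 - int v)" for v
  define Q where "Q v = q v * M" for v
  \<comment> \<open>Order: \<open>K\<close>, \<open>2 * K\<close>, blocks \<open>1\<close> to
    \<open>K - 2\<close> (left vertex, then right), \<open>n\<close>, \<open>2 * K - 1\<close>,
    \<open>K - 1\<close>. The end weights 0 and 2 match the lower bound.\<close>
  define c where "c v =
     (if int v = K then 1
      else if int v = 2 * K then K + 1
      else if int v = 2 * K + 1 then B + int s - 1
      else if int v = 2 * K - 1 then B + 2 * int s - 1
      else if int v = K - 1 then B + 2 * int s - 1 + K
      else if int v < K then Q v else Q v + K)" for v
  let ?P = "spire_pos (2 * k + 1) s"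
  have M: "M \<ge> 2" using assms by (simp add: defs)
  have facts: "M \<ge> 2" "M = 2 * K - 1" "N = K - 1" "K \<ge> 2" "int s \<ge> 2" "int s \<le> K"
      "N > 0 \<Longrightarrow> M + 2 * (N - 1) \<le> B" "N = 0 \<Longrightarrow> B = 0"
    using assms mult_diff_ge[of 0 N M] M by (auto simp: defs B_def of_nat_diff)
  have cases: "int v = K \<and> ?P v = K \<and> c v = 1 \<or>
      int v = 2 * K \<and> ?P v = 2 * K \<and> c v = K + 1 \<or>
      int v = 2 * K + 1 \<and> ?P v = int s - 1 \<and> c v = B + int s - 1 \<or>
      int v = 2 * K - 1 \<and> ?P v = 2 * K - 1 \<and> c v = B + 2 * int s - 1 \<or>
      int v = K - 1 \<and> ?P v = K - 1 \<and> c v = B + 2 * int s - 1 + K \<or>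
      int v = K - 1 - q v \<and> ?P v = K - 1 - q v \<and> c v = Q v \<and> 1 \<le> q v \<and> q v \<le> N - 1 \<and>
        M + 2 * (q v - 1) \<le> Q v \<and> Q v + M + 2 * (N - 1 - q v) \<le> B \<or>
      int v = 2 * K - 1 - q v \<and> ?P v = 2 * K - 1 - q v \<and> c v = Q v + K \<and> 1 \<le> q v \<and> q v \<le> N - 1 \<and>
        M + 2 * (q v - 1) \<le> Q v \<and> Q v + M + 2 * (N - 1 - q v) \<le> B"
    if v: "v \<in> {1..2 * k + 1}" for v
  proof -
    have "1 \<le> int v" "int v \<le> 2 * K + 1" using v by (auto simp: defs(1))
    moreover have "?P v = (if int v = 2 * K + 1 then int s - 1 else int v)"
      by (auto simp: spire_pos_def defs(1))
    moreover have "1 \<le> q v \<Longrightarrow> q v \<le> N - 1 \<Longrightarrow>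
        M + 2 * (q v - 1) \<le> Q v \<and> Q v + M + 2 * (N - 1 - q v) \<le> B"
      using mult_diff_ge[of 0 "q v" M] mult_diff_ge[of "q v" N M] M
      by (auto simp: Q_def B_def algebra_simps)
    ultimately show ?thesis using c_def[of v] q_def[of v] facts by (smt (z3))
  qed
  have rn: "2 * (int k)\<^sup>2 - 2 * int k + 2 * int s = B + 2 * int s - 1 + K"
    by (simp add: B_def defs power2_eq_square algebra_simps)
  show ?thesis
  proof (rule exI[of _ c], rule pos_labelingI)
    fix v assume "v \<in> {1..2 * k + 1}"
    from cases[OF this] show "1 \<le> c v \<and> c v \<le> 2 * (int k)\<^sup>2 - 2 * int k + 2 * int s"
      unfolding rn by (elim disjE; use facts in \<open>smt (z3)\<close>)
  next
    fix u v m d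
    assume uv: "u \<in> {1..2 * k + 1}" "v \<in> {1..2 * k + 1}" "int u \<noteq> int v"
      and m: "1 \<le> m" "?P u - ?P v \<le> m" "?P v - ?P u \<le> m"
      and d: "c u - c v \<le> d" "c v - c u \<le> d"
    have "m + d \<ge> 2 * K"
      using cases[OF uv(1)]
      \<comment> \<open>All pairs of cases; two zigzag vertices are compared by their block
        numbers.\<close>
      by (elim disjE; use cases[OF uv(2)]
        mult_trichotomy[OF M, of "q u" "q v", folded Q_def] uv(3) m d facts
        in \<open>smt (z3)\<close>)
    then show "int (2 * k + 1) - 1 \<le> m + d" by (simp add: defs)
  qed
qed

lemma pos_labeling_even_half:
  assumes "k \<ge> 2" "s = k"
  shows "\<exists>c. pos_labeling (2 * k) s c (2 * (int k)\<^sup>2 - 4 * int k + 2 * int s + 1)"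
proof -
  define K M N where "K = int k" "M = 2 * K + 1" "N = K - 2"
  define B where "B = N * M"
  note defs = K_M_N_def
  define q where "q v = (if int v < K then int v - 1 else int v - K)" for v
  define Q where "Q v = q v * M" for v
  \<comment> \<open>Order: \<open>K - 1\<close>, \<open>2 * K - 1\<close>, \<open>n\<close>,
    \<open>2 * K - 2\<close>, the blocks from \<open>1\<close> on, \<open>1\<close>,
    \<open>K\<close>. For \<open>K = 2\<close> the vertices \<open>2 * K - 2\<close> and
    \<open>1\<close> are \<open>K\<close> and \<open>K - 1\<close>, caught by earlier
    branches.\<close>
  define c where "c v =
     (if int v = K - 1 then 1
      else if int v = 2 * K - 1 then K
      else if int v = 2 * K then 2 * K - 1
      else if int v = K then B + 3 + K
      else if int v = 2 * K - 2 then 3 * K - 1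
      else if int v = 1 then B + 3
      else if int v < K then K + 1 + Q v else M + Q v)" for v
  let ?P = "spire_pos (2 * k) s"
  have M: "M \<ge> 2" using assms by (simp add: defs)
  have facts: "M \<ge> 2" "M = 2 * K + 1" "N = K - 2" "K \<ge> 2" "int s = K"
      "N > 0 \<Longrightarrow> M + 2 * (N - 1) \<le> B" "N = 0 \<Longrightarrow> B = 0"
    using assms mult_diff_ge[of 0 N M] M by (auto simp: defs B_def of_nat_diff)
  have cases: "int v = K - 1 \<and> ?P v = K - 1 \<and> c v = 1 \<or>
      int v = 2 * K - 1 \<and> ?P v = 2 * K - 1 \<and> c v = K \<or>
      int v = 2 * K \<and> ?P v = K - 1 \<and> c v = 2 * K - 1 \<or>
      int v = K \<and> ?P v = K \<and> c v = B + 3 + K \<or>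
      int v = 2 * K - 2 \<and> ?P v = 2 * K - 2 \<and> c v = 3 * K - 1 \<and> K \<ge> 3 \<or>
      int v = 1 \<and> ?P v = 1 \<and> c v = B + 3 \<and> K \<ge> 3 \<or>
      int v = 1 + q v \<and> ?P v = 1 + q v \<and> c v = K + 1 + Q v \<and> 1 \<le> q v \<and> q v \<le> N - 1 \<and>
        M + 2 * (q v - 1) \<le> Q v \<and> Q v + M + 2 * (N - 1 - q v) \<le> B \<or>
      int v = K + q v \<and> ?P v = K + q v \<and> c v = M + Q v \<and> 1 \<le> q v \<and> q v \<le> N - 1 \<and>
        M + 2 * (q v - 1) \<le> Q v \<and> Q v + M + 2 * (N - 1 - q v) \<le> B"
    if v: "v \<in> {1..2 * k}" for v
  proof -
    have "1 \<le> int v" "int v \<le> 2 * K" using v by (auto simp: defs(1))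
    moreover have "?P v = (if int v = 2 * K then int s - 1 else int v)"
      by (auto simp: spire_pos_def defs(1))
    moreover have "1 \<le> q v \<Longrightarrow> q v \<le> N - 1 \<Longrightarrow>
        M + 2 * (q v - 1) \<le> Q v \<and> Q v + M + 2 * (N - 1 - q v) \<le> B"
      using mult_diff_ge[of 0 "q v" M] mult_diff_ge[of "q v" N M] M
      by (auto simp: Q_def B_def algebra_simps)
    ultimately show ?thesis using c_def[of v] q_def[of v] facts by (smt (z3))
  qed
  have rn: "2 * (int k)\<^sup>2 - 4 * int k + 2 * int s + 1 = B + 3 + K"
    by (simp add: assms(2) B_def defs power2_eq_square algebra_simps)
  show ?thesis
  proof (rule exI[of _ c], rule pos_labelingI)
    fix v assume "v \<in> {1..2 * k}"
    from cases[OF this] show "1 \<le> c v \<and> c v \<le> 2 * (int k)\<^sup>2 - 4 * int k + 2 * int s + 1"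
      unfolding rn by (elim disjE; use facts in \<open>smt (z3)\<close>)
  next
    fix u v m d
    assume uv: "u \<in> {1..2 * k}" "v \<in> {1..2 * k}" "int u \<noteq> int v"
      and m: "1 \<le> m" "?P u - ?P v \<le> m" "?P v - ?P u \<le> m"
      and d: "c u - c v \<le> d" "c v - c u \<le> d"
    have "m + d \<ge> 2 * K - 1"
      using cases[OF uv(1)]
      by (elim disjE; use cases[OF uv(2)]
        mult_trichotomy[OF M, of "q u" "q v", folded Q_def] uv(3) m d facts
        in \<open>smt (z3)\<close>)
    then show "int (2 * k) - 1 \<le> m + d" by (simp add: defs)
  qed
qed

lemma pos_labeling_even_pred:
  assumes "k \<ge> 3" "s = k - 1"
  shows "\<exists>c. pos_labeling (2 * k) s c (2 * (int k)\<^sup>2 - 4 * int k + 2 * int s + 2)"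
proof -
  define K M N where "K = int k" "M = 2 * K - 1" "N = K - 2"
  define B where "B = N * M"
  note defs = K_M_N_def
  define q where "q v = (if int v < K then int v - 1 else int v - K - 1)" for v
  define Q where "Q v = q v * M" for v
  \<comment> \<open>Order: \<open>K - 1\<close>, \<open>2 * K - 1\<close>, the blocks from
    \<open>0\<close> on, \<open>n\<close>, \<open>K\<close>. The step from \<open>2 * K - 1\<close>
    to \<open>1\<close> is the one enlarged, so end weights 1, 1 and excess 2 attain the total of
    4.\<close>
  define c where "c v =
     (if int v = K - 1 then 1
      else if int v = 2 * K - 1 then K
      else if int v = 2 * K then B + K + 1
      else if int v = K then B + 3 * K - 2
      else if int v < K then K + 2 + Q v else 2 * K + 1 + Q v)" for v
  let ?P = "spire_pos (2 * k) s"
  have M: "M \<ge> 2" using assms by (simp add: defs)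
  have facts: "M \<ge> 2" "M = 2 * K - 1" "N = K - 2" "K \<ge> 3" "int s = K - 1"
      "N > 0 \<Longrightarrow> M + 2 * (N - 1) \<le> B" "N = 0 \<Longrightarrow> B = 0"
    using assms mult_diff_ge[of 0 N M] M by (auto simp: defs B_def of_nat_diff)
  have cases: "int v = K - 1 \<and> ?P v = K - 1 \<and> c v = 1 \<or>
      int v = 2 * K - 1 \<and> ?P v = 2 * K - 1 \<and> c v = K \<or>
      int v = 2 * K \<and> ?P v = K - 2 \<and> c v = B + K + 1 \<or>
      int v = K \<and> ?P v = K \<and> c v = B + 3 * K - 2 \<or>
      int v = 1 + q v \<and> ?P v = 1 + q v \<and> c v = K + 2 + Q v \<and> 0 \<le> q v \<and> q v \<le> N - 1 \<and>
        2 * q v \<le> Q v \<and> Q v + M + 2 * (N - 1 - q v) \<le> B \<or>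
      int v = K + 1 + q v \<and> ?P v = K + 1 + q v \<and> c v = 2 * K + 1 + Q v \<and> 0 \<le> q v \<and> q v \<le> N - 1 \<and>
        2 * q v \<le> Q v \<and> Q v + M + 2 * (N - 1 - q v) \<le> B"
    if v: "v \<in> {1..2 * k}" for v
  proof -
    have "1 \<le> int v" "int v \<le> 2 * K" using v by (auto simp: defs(1))
    moreover have "?P v = (if int v = 2 * K then int s - 1 else int v)"
      by (auto simp: spire_pos_def defs(1))
    moreover have "0 \<le> q v \<Longrightarrow> q v \<le> N - 1 \<Longrightarrow>
        2 * q v \<le> Q v \<and> Q v + M + 2 * (N - 1 - q v) \<le> B"
      \<comment> \<open>Blocks start at 0 here, so the lower estimate compares \<open>q v\<close>
        with \<open>- 1\<close>.\<close>
      using mult_diff_ge[of "- 1" "q v" M] mult_diff_ge[of "q v" N M] M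
      by (auto simp: Q_def B_def algebra_simps)
    ultimately show ?thesis using c_def[of v] q_def[of v] facts by (smt (z3))
  qed
  have rn: "2 * (int k)\<^sup>2 - 4 * int k + 2 * int s + 2 = B + 3 * K - 2"
    using assms by (simp add: B_def defs power2_eq_square algebra_simps of_nat_diff)
  show ?thesis
  proof (rule exI[of _ c], rule pos_labelingI)
    fix v assume "v \<in> {1..2 * k}"
    from cases[OF this] show "1 \<le> c v \<and> c v \<le> 2 * (int k)\<^sup>2 - 4 * int k + 2 * int s + 2"
      unfolding rn by (elim disjE; use facts in \<open>smt (z3)\<close>)
  next
    fix u v m d
    assume uv: "u \<in> {1..2 * k}" "v \<in> {1..2 * k}" "int u \<noteq> int v"
      and m: "1 \<le> m" "?P u - ?P v \<le> m" "?P v - ?P u \<le> m"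
      and d: "c u - c v \<le> d" "c v - c u \<le> d"
    have "m + d \<ge> 2 * K - 1"
      using cases[OF uv(1)]
      by (elim disjE; use cases[OF uv(2)]
        mult_trichotomy[OF M, of "q u" "q v", folded Q_def] uv(3) m d facts
        in \<open>smt (z3)\<close>)
    then show "int (2 * k) - 1 \<le> m + d" by (simp add: defs)
  qed
qed

lemma pos_labeling_even:
  assumes "2 \<le> s" "s + 2 \<le> k"
  shows "\<exists>c. pos_labeling (2 * k) s c (2 * (int k)\<^sup>2 - 4 * int k + 2 * int s + 3)"
proof -
  define K M N where "K = int k" "M = 2 * K - 1" "N = K - 3"
  define B where "B = N * M"
  note defs = K_M_N_def
  define q where "q v = (if int v < K then K - 2 - int v else 2 * K - 3 - int v)" for v
  define Q where "Q v = q v * M" for v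
  \<comment> \<open>Order: the blocks from \<open>0\<close> on, \<open>n\<close>,
    \<open>2 * K - 1\<close>, \<open>K - 1\<close>, \<open>2 * K - 2\<close>, \<open>1\<close>,
    \<open>K\<close>. The step from \<open>n\<close> to \<open>2 * K - 1\<close> is enlarged; with
    end weights 3 and 1 the total is 6.\<close>
  define c where "c v =
     (if int v = 2 * K then B + int s - 1
      else if int v = 2 * K - 1 then B + 2 * int s - 1
      else if int v = K - 1 then B + 2 * int s - 2 + K
      else if int v = 2 * K - 2 then B + 2 * int s - 2 + 2 * K
      else if int v = 1 then B + 2 * int s + 2 * K
      else if int v = K then B + 2 * int s + 3 * K
      else if int v < K then 1 + Q v else 1 + K + Q v)" for v
  let ?P = "spire_pos (2 * k) s"
  have M: "M \<ge> 2" using assms by (simp add: defs)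
  have facts: "M \<ge> 2" "M = 2 * K - 1" "N = K - 3" "int s \<ge> 2" "int s + 2 \<le> K"
      "N > 0 \<Longrightarrow> M + 2 * (N - 1) \<le> B" "N = 0 \<Longrightarrow> B = 0"
    using assms mult_diff_ge[of 0 N M] M by (auto simp: defs B_def of_nat_diff)
  have cases: "int v = 2 * K \<and> ?P v = int s - 1 \<and> c v = B + int s - 1 \<or>
      int v = 2 * K - 1 \<and> ?P v = 2 * K - 1 \<and> c v = B + 2 * int s - 1 \<or>
      int v = K - 1 \<and> ?P v = K - 1 \<and> c v = B + 2 * int s - 2 + K \<or>
      int v = 2 * K - 2 \<and> ?P v = 2 * K - 2 \<and> c v = B + 2 * int s - 2 + 2 * K \<or>
      int v = 1 \<and> ?P v = 1 \<and> c v = B + 2 * int s + 2 * K \<or>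
      int v = K \<and> ?P v = K \<and> c v = B + 2 * int s + 3 * K \<or>
      int v = K - 2 - q v \<and> ?P v = K - 2 - q v \<and> c v = 1 + Q v \<and> 0 \<le> q v \<and> q v \<le> N - 1 \<and>
        2 * q v \<le> Q v \<and> Q v + M + 2 * (N - 1 - q v) \<le> B \<or>
      int v = 2 * K - 3 - q v \<and> ?P v = 2 * K - 3 - q v \<and> c v = 1 + K + Q v \<and> 0 \<le> q v \<and> q v \<le> N - 1 \<and>
        2 * q v \<le> Q v \<and> Q v + M + 2 * (N - 1 - q v) \<le> B"
    if v: "v \<in> {1..2 * k}" for v
  proof -
    have "1 \<le> int v" "int v \<le> 2 * K" using v by (auto simp: defs(1))
    moreover have "?P v = (if int v = 2 * K then int s - 1 else int v)"
      by (auto simp: spire_pos_def defs(1))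
    moreover have "0 \<le> q v \<Longrightarrow> q v \<le> N - 1 \<Longrightarrow>
        2 * q v \<le> Q v \<and> Q v + M + 2 * (N - 1 - q v) \<le> B"
      using mult_diff_ge[of "- 1" "q v" M] mult_diff_ge[of "q v" N M] M
      by (auto simp: Q_def B_def algebra_simps)
    ultimately show ?thesis using c_def[of v] q_def[of v] facts by (smt (z3))
  qed
  have rn: "2 * (int k)\<^sup>2 - 4 * int k + 2 * int s + 3 = B + 2 * int s + 3 * K"
    by (simp add: B_def defs power2_eq_square algebra_simps)
  show ?thesis
  proof (rule exI[of _ c], rule pos_labelingI)
    fix v assume "v \<in> {1..2 * k}"
    from cases[OF this] show "1 \<le> c v \<and> c v \<le> 2 * (int k)\<^sup>2 - 4 * int k + 2 * int s + 3"
      unfolding rn by (elim disjE; use facts in \<open>smt (z3)\<close>)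
  next
    fix u v m d
    assume uv: "u \<in> {1..2 * k}" "v \<in> {1..2 * k}" "int u \<noteq> int v"
      and m: "1 \<le> m" "?P u - ?P v \<le> m" "?P v - ?P u \<le> m"
      and d: "c u - c v \<le> d" "c v - c u \<le> d"
    have "m + d \<ge> 2 * K - 1"
      using cases[OF uv(1)]
      by (elim disjE; use cases[OF uv(2)]
        mult_trichotomy[OF M, of "q u" "q v", folded Q_def] uv(3) m d facts
        in \<open>smt (z3)\<close>)
    then show "int (2 * k) - 1 \<le> m + d" by (simp add: defs)
  qed
qed

section \<open>The radio number\<close>

lemma pos_labeling_spire_rn:
  assumes "n \<ge> 4" "2 \<le> s" "s \<le> n div 2"
  shows "\<exists>c. pos_labeling n s c (spire_rn n s)"
proof -
  define k where "k = n div 2"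
  consider "odd n" | "even n" "s = k" | "even n" "s = k - 1" "s < k" | "even n" "s + 2 \<le> k"
    using assms(3) k_def by linarith
  then show ?thesis
  proof cases
    case 1
    then have "n = 2 * k + 1" unfolding k_def by presburger
    then show ?thesis using pos_labeling_odd[of k s] assms by (simp add: spire_rn_def Let_def)
  next
    case 2
    then have "n = 2 * k" unfolding k_def by presburger
    then show ?thesis using pos_labeling_even_half[of k s] assms 2
      by (simp add: spire_rn_def Let_def)
  next
    case 3
    then have "n = 2 * k" unfolding k_def by presburger
    then show ?thesis using pos_labeling_even_pred[of k s] assms 3
      by (simp add: spire_rn_def Let_def of_nat_diff)
  next
    case 4
    then have "n = 2 * k" unfolding k_def by presburger
    then show ?thesis using pos_labeling_even[of s k] assms 4
      by (simp add: spire_rn_def Let_def)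
  qed
qed

text \<open>Labeling and lower bound depend on \<open>n\<close> and \<open>s\<close> only, so the
  value is the same for every graph of the class.\<close>

theorem rn_spire_like:
  assumes "n \<ge> 4" "2 \<le> s" "s \<le> n div 2" "spire_like n s G"
  shows "int (rn G) = spire_rn n s"
proof -
  obtain c where "pos_labeling n s c (spire_rn n s)" using pos_labeling_spire_rn assms by blast
  from rn_spire_like_eqI[OF assms this] show ?thesis using spire_lower[OF assms(1-3)] by blast
qed

lemma spire_like_spires:
  "spire_like n s (spire n s)" "spire_like n s (spire1 n s)"
  "spire_like n s (spire2 n s)" "spire_like n s (spire12 n s)"
  by (auto simp: spire_like_def spire_def spire1_def spire2_def spire12_def verts_def edges_def)

theorem mainTheorem8:
  fixes n :: nat
  assumes "n \<ge> 4"
  shows "(\<forall>s. 2 \<le> s \<and> s \<le> n div 2 \<longrightarrow> rn (spire1 n s) = rn (spire n s)) \<and>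
         (\<forall>s. 3 \<le> s \<and> s \<le> n div 2 \<longrightarrow>
            rn (spire2 n s) = rn (spire n s) \<and> rn (spire12 n s) = rn (spire n s))"
proof -
  have "rn G = rn (spire n s)" if "2 \<le> s" "s \<le> n div 2" "spire_like n s G" for s G
    using rn_spire_like[OF assms that] rn_spire_like[OF assms that(1,2) spire_like_spires(1)] by simp
  then show ?thesis using spire_like_spires by auto
qed

end
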